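(* Let $G$ be a graph and let $S(G)$ be its full subdivision. Then: (i) if $\chi(G)\le 3$, then $\chi_{\mathrm{pcf}}(S(G))\le 4$; (ii) if $\chi(G)\le 4$, then $\chi_{\mathrm{o}}(S(G))\le 4$. Moreover, there exist bipartite graphs $G$ with $\chi_{\mathrm{o}}(S(G))=4$.
   Context: Graphs are finite and simple. The full subdivision $S(G)$ is the graph obtained from $G$ by subdividing each edge exactly once. $\chi(G)$ is the chromatic number. A proper odd (resp. proper conflict-free) coloring is a proper vertex coloring in which for every non-isolated vertex some color appears an odd number of times (resp. exactly once) in its open neighborhood; $\chi_{\mathrm{o}}$ (resp. $\chi_{\mathrm{pcf}}$) is the least number of colors in such a coloring. *)

theory Defs
  imports Main
begin

datatype 'a graph = Graph (verts: "'a set") (edges: "'a set set")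

text \<open>Finite simple graphs; an edge is the two-element set of its endpoints.\<close>

definition fin_simple_graph :: "'a graph \<Rightarrow> bool" where
  "fin_simple_graph G \<longleftrightarrow>
     finite (verts G) \<and> (\<forall>e \<in> edges G. e \<subseteq> verts G \<and> card e = 2)"

definition neighborhood :: "'a graph \<Rightarrow> 'a \<Rightarrow> 'a set" where
  "neighborhood G v = {u \<in> verts G. {u, v} \<in> edges G}"

text \<open>The original vertices become \<open>Inl v\<close>; the new vertex subdividing the edge \<open>e\<close> is \<open>Inr e\<close>,
  and it is joined to the two endpoints of \<open>e\<close>.\<close>

definition full_subdivision :: "'a graph \<Rightarrow> ('a + 'a set) graph" where
  "full_subdivision G =
     Graph (Inl ` verts G \<union> Inr ` edges G)
           {{Inl v, Inr e} | v e. e \<in> edges G \<and> v \<in> e}"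

definition proper_coloring :: "'a graph \<Rightarrow> nat \<Rightarrow> ('a \<Rightarrow> nat) \<Rightarrow> bool" where
  "proper_coloring G k c \<longleftrightarrow>
     c ` verts G \<subseteq> {..<k} \<and>
     (\<forall>u \<in> verts G. \<forall>v \<in> verts G. {u, v} \<in> edges G \<longrightarrow> c u \<noteq> c v)"

definition proper_odd_coloring :: "'a graph \<Rightarrow> nat \<Rightarrow> ('a \<Rightarrow> nat) \<Rightarrow> bool" where
  "proper_odd_coloring G k c \<longleftrightarrow>
     proper_coloring G k c \<and>
     (\<forall>v \<in> verts G. neighborhood G v \<noteq> {} \<longrightarrow>
        (\<exists>i. odd (card {u \<in> neighborhood G v. c u = i})))"

definition proper_cf_coloring :: "'a graph \<Rightarrow> nat \<Rightarrow> ('a \<Rightarrow> nat) \<Rightarrow> bool" where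
  "proper_cf_coloring G k c \<longleftrightarrow>
     proper_coloring G k c \<and>
     (\<forall>v \<in> verts G. neighborhood G v \<noteq> {} \<longrightarrow>
        (\<exists>i. card {u \<in> neighborhood G v. c u = i} = 1))"

text \<open>The minima below exist for finite simple graphs, since an injective coloring qualifies
  for all three notions (lemma \<open>ex_colorings\<close>).\<close>

definition chromatic_number :: "'a graph \<Rightarrow> nat" where
  "chromatic_number G = (LEAST k. \<exists>c. proper_coloring G k c)"

definition odd_chromatic_number :: "'a graph \<Rightarrow> nat" where
  "odd_chromatic_number G = (LEAST k. \<exists>c. proper_odd_coloring G k c)"

definition pcf_chromatic_number :: "'a graph \<Rightarrow> nat" where
  "pcf_chromatic_number G = (LEAST k. \<exists>c. proper_cf_coloring G k c)"

definition bipartite :: "'a graph \<Rightarrow> bool" where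
  "bipartite G \<longleftrightarrow>
     (\<exists>A B. A \<union> B = verts G \<and> A \<inter> B = {} \<and>
        (\<forall>e \<in> edges G. \<exists>a \<in> A. \<exists>b \<in> B. e = {a, b}))"

lemma fin_simple_graph_full_subdivision:
  assumes "fin_simple_graph G"
  shows "fin_simple_graph (full_subdivision G)"
proof -
  have "edges G \<subseteq> Pow (verts G)" and "finite (verts G)"
    using assms by (auto simp: fin_simple_graph_def)
  then have "finite (edges G)"
    by (meson finite_Pow_iff finite_subset)
  with assms show ?thesis
    by (fastforce simp: fin_simple_graph_def full_subdivision_def)
qed

lemma ex_colorings:
  assumes "fin_simple_graph G"
  shows "\<exists>k c. proper_coloring G k c \<and> proper_odd_coloring G k c \<and> proper_cf_coloring G k c"
proof -
  have fin: "finite (verts G)"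
    and loopless: "\<And>u v. {u, v} \<in> edges G \<Longrightarrow> u \<noteq> v"
    using assms by (fastforce simp: fin_simple_graph_def)+
  obtain c :: "'a \<Rightarrow> nat" and k where c: "c ` verts G = {i. i < k}" "inj_on c (verts G)"
    using finite_imp_inj_to_nat_seg[OF fin] by blast
  have proper: "proper_coloring G k c"
    unfolding proper_coloring_def
  proof (intro conjI ballI impI)
    show "c ` verts G \<subseteq> {..<k}"
      using c(1) by auto
    show "c u \<noteq> c v" if "u \<in> verts G" "v \<in> verts G" "{u, v} \<in> edges G" for u v
      using loopless[OF that(3)] inj_onD[OF c(2) _ that(1,2)] by blast
  qed
  have cf: "\<exists>i. card {u \<in> neighborhood G v. c u = i} = 1"
    if "neighborhood G v \<noteq> {}" for v
  proof -
    from that obtain w where "w \<in> neighborhood G v" by blast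
    then have "{u \<in> neighborhood G v. c u = c w} = {w}"
      using c(2) by (auto simp: neighborhood_def inj_on_def)
    then have "card {u \<in> neighborhood G v. c u = c w} = 1" by simp
    then show ?thesis by blast
  qed
  then have "\<exists>i. odd (card {u \<in> neighborhood G v. c u = i})"
    if "neighborhood G v \<noteq> {}" for v
    using that by (metis odd_one)
  with proper cf show ?thesis
    unfolding proper_odd_coloring_def proper_cf_coloring_def by blast
qed

end

theory Submission
  imports Defs
begin

text \<open>
  (i) Take a maximal matching \<open>M\<close> of \<open>G\<close>. The vertices missed by \<open>M\<close> are independent and get the
  fourth colour, as do the edges of \<open>M\<close>, so every matched vertex sees the fourth colour exactly
  once. The edges at a missed vertex each have two admissible colours among the first three, which
  is enough to single out one of them; no two missed vertices compete for an edge.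

  (ii) Every edge has two admissible colours, and changing a single edge at a vertex with only even
  counts creates an odd count there. Working towards the root of a spanning tree, one thus repairs
  all vertices but the root. In a component, let \<open>v\<close> be a leaf of a spanning tree and root the tree
  without \<open>v\<close> at a neighbour \<open>x\<close> of \<open>v\<close>. The edge \<open>vx\<close> then repairs \<open>x\<close>, provided \<open>v\<close> tolerates both
  colours of \<open>vx\<close>. If \<open>v\<close> has a neighbour \<open>y\<close> with a colour other than that of \<open>x\<close>, the colour of
  \<open>vy\<close> can be chosen such that the colour of \<open>x\<close> occurs an odd number of times around \<open>v\<close>; otherwise
  \<open>v\<close> itself may be recoloured.

  The 4-cycle needs four colours: a 3-colouring of its subdivision is determined by a proper
  3-colouring of the cycle, which has two equally coloured opposite vertices.
\<close>

section \<open>Free colours and the two ends of an edge\<close>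

lemma ex_less_notin:
  fixes A :: "nat set"
  assumes "finite A" "card A < k"
  shows "\<exists>j<k. j \<notin> A"
proof (rule ccontr)
  assume "\<not> ?thesis"
  then have "{..<k} \<subseteq> A" by auto
  then have "k \<le> card A" using card_mono[OF assms(1), of "{..<k}"] by simp
  with assms(2) show False by simp
qed

lemma finite_edges:
  assumes "fin_simple_graph G"
  shows "finite (edges G)"
proof -
  have "edges G \<subseteq> Pow (verts G)" and "finite (verts G)"
    using assms by (auto simp: fin_simple_graph_def)
  then show ?thesis by (meson finite_Pow_iff finite_subset)
qed

lemma edge_doubleton:
  assumes "fin_simple_graph G" "e \<in> edges G" "v \<in> e"
  obtains w where "e = {v, w}" "w \<noteq> v" "v \<in> verts G" "w \<in> verts G"
proof -
  have "card e = 2" "e \<subseteq> verts G" using assms by (auto simp: fin_simple_graph_def)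
  with assms(3) show thesis by (auto simp: card_2_iff intro: that)
qed

lemma ex_less_notin_image_edge:
  fixes a :: "'a \<Rightarrow> nat"
  assumes "fin_simple_graph G" "e \<in> edges G" "2 < k"
  shows "\<exists>j<k. j \<notin> a ` e"
proof -
  have "card e = 2" "finite e"
    using assms by (auto simp: fin_simple_graph_def intro: card_ge_0_finite)
  with card_image_le[of e a] assms(3) show ?thesis by (intro ex_less_notin) auto
qed

section \<open>Colourings of the full subdivision\<close>

definition subdivision_labelling ::
    "'a graph \<Rightarrow> nat \<Rightarrow> ('a \<Rightarrow> nat) \<Rightarrow> ('a set \<Rightarrow> nat) \<Rightarrow> bool" where
  "subdivision_labelling G k c f \<longleftrightarrow>
     (\<forall>v \<in> verts G. c v < k) \<and>
     (\<forall>e \<in> edges G. f e < k \<and> inj_on c e \<and> f e \<notin> c ` e)"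

lemma edge_full_subdivision_iff [simp]:
  "{Inl v, Inr e} \<in> edges (full_subdivision G) \<longleftrightarrow> e \<in> edges G \<and> v \<in> e"
  "{Inr e, Inl v} \<in> edges (full_subdivision G) \<longleftrightarrow> e \<in> edges G \<and> v \<in> e"
  "{Inl v, Inl w} \<notin> edges (full_subdivision G)"
  "{Inr e, Inr e'} \<notin> edges (full_subdivision G)"
  by (auto simp: full_subdivision_def doubleton_eq_iff)

lemma vertex_full_subdivision_iff [simp]:
  "Inl v \<in> verts (full_subdivision G) \<longleftrightarrow> v \<in> verts G"
  "Inr e \<in> verts (full_subdivision G) \<longleftrightarrow> e \<in> edges G"
  by (auto simp: full_subdivision_def)

lemma neighborhood_subdivision_Inl:
  "neighborhood (full_subdivision G) (Inl v) = Inr ` {e \<in> edges G. v \<in> e}"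
proof (rule set_eqI)
  show "u \<in> neighborhood (full_subdivision G) (Inl v) \<longleftrightarrow>
      u \<in> Inr ` {e \<in> edges G. v \<in> e}" for u
    by (cases u) (auto simp: neighborhood_def)
qed

lemma neighborhood_subdivision_Inr:
  assumes "fin_simple_graph G" "e \<in> edges G"
  shows "neighborhood (full_subdivision G) (Inr e) = Inl ` e"
proof (rule set_eqI)
  show "u \<in> neighborhood (full_subdivision G) (Inr e) \<longleftrightarrow> u \<in> Inl ` e" for u
    using assms by (cases u) (auto simp: neighborhood_def fin_simple_graph_def)
qed

lemma card_subdivision_Inl:
  fixes G :: "'a graph"
  shows
  "card {u \<in> neighborhood (full_subdivision G) (Inl v). case_sum c f u = i} =
    card {e \<in> edges G. v \<in> e \<and> f e = i}"
proof -
  have "{u \<in> neighborhood (full_subdivision G) (Inl v). case_sum c f u = i} =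
      Inr ` {e \<in> edges G. v \<in> e \<and> f e = i}"
  proof (rule set_eqI)
    show "u \<in> {u \<in> neighborhood (full_subdivision G) (Inl v). case_sum c f u = i} \<longleftrightarrow>
        u \<in> Inr ` {e \<in> edges G. v \<in> e \<and> f e = i}" for u :: "'a + 'a set"
      by (cases u) (auto simp: neighborhood_subdivision_Inl)
  qed
  then show ?thesis by (simp add: card_image)
qed

lemma proper_coloring_subdivision:
  assumes "subdivision_labelling G k c f"
  shows "proper_coloring (full_subdivision G) k (case_sum c f)"
  unfolding proper_coloring_def
proof (intro conjI ballI impI)
  show "case_sum c f ` verts (full_subdivision G) \<subseteq> {..<k}"
    using assms by (auto simp: subdivision_labelling_def full_subdivision_def)
next
  fix x y :: "'a + 'a set"
  assume "{x, y} \<in> edges (full_subdivision G)"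
  moreover have "c v \<noteq> f e" "f e \<noteq> c v" if "e \<in> edges G" "v \<in> e" for v e
    using assms that by (auto simp: subdivision_labelling_def image_iff) metis+
  ultimately show "case_sum c f x \<noteq> case_sum c f y"
    by (cases x; cases y) auto
qed

text \<open>\<open>P\<close> is oddness for odd colourings and equality to \<open>1\<close> for conflict-free ones.\<close>

lemma subdivision_neighborhoods:
  assumes G: "fin_simple_graph G" and lab: "subdivision_labelling G k c f"
    and "P (1 :: nat)"
    and P: "\<And>v. v \<in> verts G \<Longrightarrow> {e \<in> edges G. v \<in> e} \<noteq> {} \<Longrightarrow>
      \<exists>i. P (card {e \<in> edges G. v \<in> e \<and> f e = i})"
    and w: "w \<in> verts (full_subdivision G)" "neighborhood (full_subdivision G) w \<noteq> {}"
  shows "\<exists>i. P (card {u \<in> neighborhood (full_subdivision G) w. case_sum c f u = i})"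
proof (cases w)
  case (Inl v)
  then have v: "v \<in> verts G" using w(1) by simp
  then have "{e \<in> edges G. v \<in> e} \<noteq> {}"
    using w(2) Inl by (auto simp: neighborhood_subdivision_Inl)
  with P[OF v] v Inl show ?thesis by (simp add: card_subdivision_Inl)
next
  case (Inr e)
  then have e: "e \<in> edges G" using w(1) by simp
  then have "card e = 2" using G by (auto simp: fin_simple_graph_def)
  then obtain v where v: "v \<in> e" by fastforce
  have inj: "inj_on c e" using lab e by (auto simp: subdivision_labelling_def)
  \<comment> \<open>The two ends of \<open>e\<close> differ in colour, so the colour of one of them
    occurs exactly once.\<close>
  have "{u \<in> neighborhood (full_subdivision G) w. case_sum c f u = c v} = {Inl v}"
    using v inj Inr by (auto simp: neighborhood_subdivision_Inr[OF G e] inj_on_def)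
  then have "card {u \<in> neighborhood (full_subdivision G) w. case_sum c f u = c v} = 1"
    by simp
  with \<open>P 1\<close> show ?thesis by metis
qed

section \<open>Conflict-free colourings\<close>

text \<open>An edge disjoint from every member of an inclusion-maximal matching could be added to
  it. Hence the vertices missed by \<open>M\<close> will be independent.\<close>

lemma ex_maximal_matching:
  assumes "finite E"
  obtains M where "M \<subseteq> E" "pairwise disjnt M"
    "\<And>e. e \<in> E \<Longrightarrow> e \<noteq> {} \<Longrightarrow> e \<inter> \<Union>M \<noteq> {}"
proof -
  let ?S = "{M. M \<subseteq> E \<and> pairwise disjnt M}"
  have "finite ?S" using assms by simp
  moreover have "{} \<in> ?S" by simp
  ultimately obtain M where M: "M \<in> ?S" "\<And>M'. M' \<in> ?S \<Longrightarrow> M \<subseteq> M' \<Longrightarrow> M = M'"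
    by (metis (no_types, lifting) finite_has_maximal2)
  have "e \<inter> \<Union>M \<noteq> {}" if "e \<in> E" "e \<noteq> {}" for e
  proof
    assume d: "e \<inter> \<Union>M = {}"
    then have "insert e M \<in> ?S"
      using M(1) that(1) by (auto simp: pairwise_insert disjnt_def)
    from M(2)[OF this] have "e \<in> M" by blast
    with d that(2) show False by blast
  qed
  with M(1) show thesis by (intro that[of M]) auto
qed

lemma ex_cf_labelling:
  fixes G :: "'a graph"
  assumes G: "fin_simple_graph G" and c0: "proper_coloring G 3 c0"
  shows "\<exists>c f. subdivision_labelling G 4 c f \<and>
    (\<forall>v \<in> verts G. {e \<in> edges G. v \<in> e} \<noteq> {} \<longrightarrow>
      (\<exists>i. card {e \<in> edges G. v \<in> e \<and> f e = i} = 1))"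
proof -
  obtain M where M: "M \<subseteq> edges G" "pairwise disjnt M"
    and max: "\<And>e. e \<in> edges G \<Longrightarrow> e \<noteq> {} \<Longrightarrow> e \<inter> \<Union>M \<noteq> {}"
    using ex_maximal_matching[OF finite_edges[OF G]] by blast
  have edge: "finite e" "card e = 2" "e \<subseteq> verts G" if "e \<in> edges G" for e
    using G that by (auto simp: fin_simple_graph_def intro: card_ge_0_finite)
  have c0_less: "c0 v < 3" if "v \<in> verts G" for v
    using c0 that by (auto simp: proper_coloring_def)
  have c0_neq: "c0 u \<noteq> c0 v" if "{u, v} \<in> edges G" for u v
    using c0 edge(3)[OF that] that by (auto simp: proper_coloring_def)
  have matched: "w \<in> \<Union>M" if "{v, w} \<in> edges G" "v \<notin> \<Union>M" for v w
    using max[OF that(1)] that(2) by auto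
  have avoid: "\<exists>k<3. k \<notin> a ` e" if "e \<in> edges G" for e and a :: "'a \<Rightarrow> nat"
    using ex_less_notin_image_edge[OF G that] by simp
  obtain t where t: "\<And>e. e \<in> edges G \<Longrightarrow> t e < 3 \<and> t e \<notin> c0 ` e"
    using avoid[of _ c0] by metis
  have "\<exists>e. {e \<in> edges G. v \<in> e} \<noteq> {} \<longrightarrow> e \<in> edges G \<and> v \<in> e" for v by blast
  then obtain g where g: "\<And>v. {e \<in> edges G. v \<in> e} \<noteq> {} \<Longrightarrow> g v \<in> edges G \<and> v \<in> g v"
    by metis
  \<comment> \<open>For a missed vertex, \<open>a v\<close> is the colour reserved for its chosen
    edge \<open>g v\<close>, treated as if it were the colour of \<open>v\<close>. Choosing
    \<open>t'\<close> against \<open>a\<close> therefore keeps the other edges at \<open>v\<close>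
    away from the reserved colour.\<close>
  define a where "a v = (if v \<in> \<Union>M then c0 v else t (g v))" for v
  obtain t' where t': "\<And>e. e \<in> edges G \<Longrightarrow> t' e < 3 \<and> t' e \<notin> a ` e"
    using avoid[of _ a] by metis
  define c where "c v = (if v \<in> \<Union>M then c0 v else 3)" for v
  define f where "f e =
    (if e \<in> M then 3 else if \<exists>v. v \<notin> \<Union>M \<and> v \<in> e \<and> e = g v then t e else t' e)" for e
  have f_less: "f e < 3" if "e \<in> edges G" "e \<notin> M" for e
    using t t' that by (auto simp: f_def)
  have lab: "subdivision_labelling G 4 c f"
    unfolding subdivision_labelling_def
  proof (intro conjI ballI)
    fix v assume "v \<in> verts G"
    then show "c v < 4" using c0_less[of v] by (simp add: c_def)
  next
    fix e assume e: "e \<in> edges G"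
    show "f e < 4" using f_less[OF e] by (cases "e \<in> M") (auto simp: f_def)
    show "inj_on c e"
    proof (rule inj_onI, rule ccontr)
      fix u v assume uv: "u \<in> e" "v \<in> e" "c u = c v" "u \<noteq> v"
      from edge_doubleton[OF G e uv(1)] uv have e': "e = {u, v}" by blast
      have "c0 u \<noteq> c0 v" "c0 u < 3" "c0 v < 3"
        using c0_neq c0_less edge(3)[OF e] e e' by auto
      \<comment> \<open>By maximality the colour 3 is not given to both ends.\<close>
      moreover have "u \<in> \<Union>M \<or> v \<in> \<Union>M" using max[OF e] e' by auto
      ultimately show False using uv(3) by (auto simp: c_def split: if_splits)
    qed
    show "f e \<notin> c ` e"
    proof
      assume "f e \<in> c ` e"
      then obtain v where v: "v \<in> e" "f e = c v" by blast
      have lt: "c0 v < 3" using c0_less edge(3)[OF e] v(1) by auto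
      show False
      proof (cases "e \<in> M")
        case True
        then have "v \<in> \<Union>M" using v(1) by blast
        with True v(2) lt show False by (simp add: f_def c_def)
      next
        case False
        \<comment> \<open>The missed vertices have colour 3, which lies only on edges of
          \<open>M\<close>; so a clash could only occur at a matched vertex, where \<open>t\<close>
          and \<open>t'\<close> both avoid \<open>c0 v\<close>.\<close>
        then have "v \<in> \<Union>M" using f_less[OF e] v(2) by (auto simp: c_def split: if_splits)
        then have "c v = c0 v" "a v = c0 v" by (auto simp: c_def a_def)
        moreover have "f e = t e \<or> f e = t' e" using False by (auto simp: f_def)
        ultimately show False using t[OF e] t'[OF e] v by (metis imageI)
      qed
    qed
  qed
  have "\<exists>i. card {e \<in> edges G. v \<in> e \<and> f e = i} = 1"
    if v: "v \<in> verts G" and ne: "{e \<in> edges G. v \<in> e} \<noteq> {}" for v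
  proof (cases "v \<in> \<Union>M")
    case True
    then obtain m where m: "m \<in> M" "v \<in> m" by blast
    have "{e \<in> edges G. v \<in> e \<and> f e = 3} = {m}"
    proof (intro equalityI subsetI)
      fix e assume "e \<in> {e \<in> edges G. v \<in> e \<and> f e = 3}"
      then have e: "e \<in> edges G" "v \<in> e" "f e = 3" by auto
      with f_less have "e \<in> M" by fastforce
      with M(2) m e(2) show "e \<in> {m}" by (auto simp: pairwise_def disjnt_def)
    next
      fix e assume "e \<in> {m}"
      then show "e \<in> {e \<in> edges G. v \<in> e \<and> f e = 3}" using m M(1) by (auto simp: f_def)
    qed
    then show ?thesis by (metis is_singletonI is_singleton_altdef)
  next
    case False
    note gv = g[OF ne]
    have "{e \<in> edges G. v \<in> e \<and> f e = t (g v)} = {g v}"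
    proof (intro equalityI subsetI)
      fix e assume "e \<in> {e \<in> edges G. v \<in> e \<and> f e = t (g v)}"
      then have e: "e \<in> edges G" "v \<in> e" "f e = t (g v)" by auto
      have "e \<notin> M" using False e(2) by blast
      \<comment> \<open>Since \<open>a v\<close> is \<open>t (g v)\<close>, an edge at
        \<open>v\<close> with the reserved colour must be coloured by \<open>t\<close>, hence be the
        chosen edge of some missed vertex \<open>u\<close>. Independence of the missed vertices
        gives \<open>u = v\<close>.\<close>
      moreover have "t' e \<noteq> t (g v)"
        using t'[OF e(1)] e(2) False by (auto simp: a_def)
      ultimately obtain u where u: "u \<notin> \<Union>M" "u \<in> e" "e = g u"
        using e(3) by (auto simp: f_def split: if_splits)
      have "u = v"
      proof (rule ccontr)
        assume "u \<noteq> v"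
        with edge_doubleton[OF G e(1,2)] u(2) have "e = {v, u}" by blast
        with matched[of v u] e(1) False u(1) show False by blast
      qed
      with u show "e \<in> {g v}" by simp
    next
      fix e assume "e \<in> {g v}"
      then show "e \<in> {e \<in> edges G. v \<in> e \<and> f e = t (g v)}"
        using gv False by (auto simp: f_def)
    qed
    then show ?thesis by (metis is_singletonI is_singleton_altdef)
  qed
  with lab show ?thesis by blast
qed

section \<open>Odd colourings\<close>

text \<open>False at a vertex in no member of \<open>E\<close>, where all counts are 0; hence
  isolated vertices are excluded explicitly below.\<close>

definition odd_at :: "'a set set \<Rightarrow> ('a set \<Rightarrow> nat) \<Rightarrow> 'a \<Rightarrow> bool" where
  "odd_at E f v \<longleftrightarrow> (\<exists>i. odd (card {e \<in> E. v \<in> e \<and> f e = i}))"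

lemma odd_atI: "odd (card {e \<in> E. v \<in> e \<and> f e = i}) \<Longrightarrow> odd_at E f v"
  by (auto simp: odd_at_def)

lemma odd_at_cong:
  assumes "\<And>e. e \<in> E \<Longrightarrow> v \<in> e \<Longrightarrow> f e = g e"
  shows "odd_at E f v \<longleftrightarrow> odd_at E g v"
proof -
  have "{e \<in> E. v \<in> e \<and> f e = i} = {e \<in> E. v \<in> e \<and> g e = i}" for i
    using assms by auto
  then show ?thesis by (simp add: odd_at_def)
qed

lemma card_fun_upd:
  assumes "finite E" "e \<in> E" "v \<in> e" "q \<noteq> f e"
  shows "card {e' \<in> E. v \<in> e' \<and> (f(e := q)) e' = q} =
    Suc (card {e' \<in> E. v \<in> e' \<and> f e' = q})"
proof -
  have "{e' \<in> E. v \<in> e' \<and> (f(e := q)) e' = q} = insert e {e' \<in> E. v \<in> e' \<and> f e' = q}"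
    using assms by auto
  with assms show ?thesis by simp
qed

text \<open>All counts at \<open>v\<close> were even, and the new colour \<open>q\<close> gains
  exactly one edge.\<close>

lemma odd_at_fun_upd:
  assumes "finite E" "e \<in> E" "v \<in> e" "q \<noteq> f e" "\<not> odd_at E f v"
  shows "odd_at E (f(e := q)) v"
proof -
  have "even (card {e' \<in> E. v \<in> e' \<and> f e' = q})"
    using assms(5) by (simp add: odd_at_def)
  then have "odd (card {e' \<in> E. v \<in> e' \<and> (f(e := q)) e' = q})"
    by (simp only: card_fun_upd[where f = f, OF assms(1-4)] even_Suc simp_thms)
  then show ?thesis by (rule odd_atI)
qed

lemma subdivision_labelling_fun_upd:
  "subdivision_labelling G k c f \<Longrightarrow> q < k \<Longrightarrow> q \<notin> c ` e \<Longrightarrow>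
    subdivision_labelling G k c (f(e := q))"
  by (auto simp: subdivision_labelling_def)

text \<open>The ends of \<open>e\<close> block at most two of the four colours, so there is an
  admissible colour besides \<open>f e\<close>. If \<open>f e\<close> leaves only even counts at
  \<open>v\<close>, switching to it makes one odd.\<close>

lemma repair_vertex:
  assumes G: "fin_simple_graph G" and lab: "subdivision_labelling G 4 c f"
    and e: "e \<in> edges G" "v \<in> e"
  obtains q where "q < 4" "q \<notin> c ` e" "odd_at (edges G) (f(e := q)) v"
proof (cases "odd_at (edges G) f v")
  case True
  then show thesis using lab e by (intro that[of "f e"]) (auto simp: subdivision_labelling_def)
next
  case False
  have "finite e" "card e = 2"
    using G e(1) by (auto simp: fin_simple_graph_def intro: card_ge_0_finite)
  then have "card (insert (f e) (c ` e)) < 4"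
    using card_insert_le_m1[of 3 "c ` e" "f e"] card_image_le[of e c] by simp
  then obtain q where "q < 4" "q \<notin> insert (f e) (c ` e)"
    using ex_less_notin[of "insert (f e) (c ` e)"] \<open>finite e\<close> by auto
  with odd_at_fun_upd[OF finite_edges[OF G] e _ False] show thesis by (intro that[of q]) auto
qed

text \<open>\<open>W\<close> is the vertex set of a tree rooted at \<open>r\<close>, built one leaf
  at a time. Induction thus removes the last leaf together with an edge to its parent.\<close>

inductive grown :: "'a set set \<Rightarrow> 'a \<Rightarrow> 'a set \<Rightarrow> bool" for E r where
  root: "grown E r {r}"
| grow: "grown E r W \<Longrightarrow> p \<in> W \<Longrightarrow> v \<notin> W \<Longrightarrow> {p, v} \<in> E \<Longrightarrow> grown E r (insert v W)"

lemma grown_root: "grown E r W \<Longrightarrow> r \<in> W"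
  by (induction rule: grown.induct) auto

text \<open>Attach the old root below \<open>v\<close> first, then replay the growth.\<close>

lemma grown_new_root:
  "grown E r W \<Longrightarrow> v \<notin> W \<Longrightarrow> {v, r} \<in> E \<Longrightarrow> grown E v (insert v W)"
proof (induction rule: grown.induct)
  case root
  then show ?case using grown.grow[OF grown.root, of v v r E] by (simp add: insert_commute)
next
  case (grow W p u)
  then have "grown E v (insert u (insert v W))"
    by (intro grown.grow[of _ _ "insert v W" p]) auto
  then show ?case by (simp add: insert_commute)
qed

text \<open>If the new root is the last leaf, reroot the rest at its parent and hang it below the
  leaf; otherwise reroot the rest at \<open>p\<close> and grow the leaf again.\<close>

lemma grown_reroot: "grown E r W \<Longrightarrow> p \<in> W \<Longrightarrow> grown E p W"
proof (induction arbitrary: p rule: grown.induct)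
  case root
  then show ?case by (auto intro: grown.root)
next
  case (grow W q v)
  show ?case
  proof (cases "p = v")
    case True
    then show ?thesis using grow grown_new_root[of E q W v] by (simp add: insert_commute)
  next
    case False
    then show ?thesis using grow by (auto intro: grown.grow)
  qed
qed

text \<open>An edge leaving a maximal grown set would allow a further growth step.\<close>

lemma ex_component:
  assumes G: "fin_simple_graph G" and r: "r \<in> verts G"
  obtains W where "grown (edges G) r W" "W \<subseteq> verts G"
    "\<And>e. e \<in> edges G \<Longrightarrow> e \<inter> W \<noteq> {} \<Longrightarrow> e \<subseteq> W"
proof -
  let ?S = "{W. W \<subseteq> verts G \<and> grown (edges G) r W}"
  have "finite ?S" using G by (auto simp: fin_simple_graph_def)
  moreover have "{r} \<in> ?S" using r by (auto intro: grown.root)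
  ultimately obtain W where W: "W \<in> ?S" "\<And>W'. W' \<in> ?S \<Longrightarrow> W \<subseteq> W' \<Longrightarrow> W = W'"
    by (metis (no_types, lifting) finite_has_maximal2)
  have "e \<subseteq> W" if e: "e \<in> edges G" "e \<inter> W \<noteq> {}" for e
  proof -
    from e(2) obtain p where p: "p \<in> e" "p \<in> W" by blast
    obtain v where v: "e = {p, v}" "v \<in> verts G" using edge_doubleton[OF G e(1) p(1)] by metis
    have "v \<in> W"
    proof (rule ccontr)
      assume "v \<notin> W"
      then have "insert v W \<in> ?S" using W(1) v e(1) p(2) by (auto intro: grown.grow)
      with W(2)[of "insert v W"] \<open>v \<notin> W\<close> show False by blast
    qed
    with p v show ?thesis by simp
  qed
  with W(1) show thesis by (intro that[of W]) auto
qed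

text \<open>The last leaf \<open>v\<close> is repaired first, through the edge to its parent. The
  induction then changes only edges inside the smaller set \<open>W\<close>, none of which contains
  \<open>v\<close>; this is why the last conjunct is carried along.\<close>

lemma repair_all_but_root:
  assumes G: "fin_simple_graph G"
    and "grown (edges G) r W" "subdivision_labelling G 4 c f"
  shows "\<exists>f'. subdivision_labelling G 4 c f' \<and> (\<forall>v \<in> W - {r}. odd_at (edges G) f' v) \<and>
    (\<forall>e. \<not> e \<subseteq> W \<longrightarrow> f' e = f e)"
  using assms(2,3)
proof (induction arbitrary: f rule: grown.induct)
  case root
  then show ?case by auto
next
  case (grow W p v)
  obtain q where q: "q < 4" "q \<notin> c ` {p, v}" "odd_at (edges G) (f({p, v} := q)) v"
    using repair_vertex[OF G grow.prems grow.hyps(4), of v] by auto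
  have "subdivision_labelling G 4 c (f({p, v} := q))"
    using grow.prems q by (intro subdivision_labelling_fun_upd)
  from grow.IH[OF this] obtain f' where f': "subdivision_labelling G 4 c f'"
    "\<forall>u \<in> W - {r}. odd_at (edges G) f' u" "\<forall>e. \<not> e \<subseteq> W \<longrightarrow> f' e = (f({p, v} := q)) e"
    by blast
  have "odd_at (edges G) f' v \<longleftrightarrow> odd_at (edges G) (f({p, v} := q)) v"
    using f'(3) grow.hyps(3) by (intro odd_at_cong) blast
  with q(3) have "\<forall>u \<in> insert v W - {r}. odd_at (edges G) f' u" using f'(2) by auto
  moreover have "f' e = f e" if "\<not> e \<subseteq> insert v W" for e
  proof -
    have "\<not> e \<subseteq> W" "e \<noteq> {p, v}" using that grow.hyps(2) by auto
    with f'(3) show ?thesis by simp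
  qed
  ultimately show ?case using f'(1) by blast
qed

text \<open>Here \<open>v\<close> tolerates both colours of \<open>vx\<close>: the colour of \<open>x\<close> is not one of them, and the
  colour of \<open>vy\<close> decides whether it occurs an odd number of times around \<open>v\<close>.\<close>

lemma repair_leaf_two_colors:
  assumes G: "fin_simple_graph G" and lab: "subdivision_labelling G 4 c f"
    and W: "grown (edges G) x W" "v \<notin> W" "{v, x} \<in> edges G" "{v, y} \<in> edges G" "c y \<noteq> c x"
  shows "\<exists>f'. subdivision_labelling G 4 c f' \<and> (\<forall>u \<in> insert v W. odd_at (edges G) f' u) \<and>
    (\<forall>e \<in> edges G. e \<inter> insert v W = {} \<longrightarrow> f' e = f e)"
proof -
  note fin = finite_edges[OF G]
  let ?cnt = "\<lambda>f. card {e \<in> edges G. v \<in> e \<and> f e = c x}"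
  have "inj_on c {v, x}" using lab W by (auto simp: subdivision_labelling_def)
  moreover have "v \<noteq> x" using grown_root[OF W(1)] W(2) by auto
  ultimately have cx: "c v \<noteq> c x" by auto
  have cx4: "c x < 4" using lab W(3) G
    by (auto simp: subdivision_labelling_def fin_simple_graph_def)
  obtain f1 where f1: "subdivision_labelling G 4 c f1" "odd (?cnt f1)"
    "\<forall>e. e \<noteq> {v, y} \<longrightarrow> f1 e = f e"
  proof (cases "odd (?cnt f)")
    case True
    then show thesis using that lab by blast
  next
    case False
    show thesis
    proof (cases "f {v, y} = c x")
      case True
      \<comment> \<open>Parity is changed by taking \<open>c x\<close> off the edge
        \<open>vy\<close>; the fourth colour replaces it.\<close>
      have "card {c v, c y, c x} < 4" using card_insert_le_m1[of 3 "{c y, c x}" "c v"]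
        card_insert_le_m1[of 2 "{c x}" "c y"] by simp
      then obtain d where d: "d < 4" "d \<notin> {c v, c y, c x}"
        using ex_less_notin[of "{c v, c y, c x}" 4] by blast
      have "{e \<in> edges G. v \<in> e \<and> f e = c x} =
          insert {v, y} {e \<in> edges G. v \<in> e \<and> (f({v, y} := d)) e = c x}"
        using True W(4) by auto
      then have "?cnt f = Suc (?cnt (f({v, y} := d)))"
        using fin d by simp
      with False have "odd (?cnt (f({v, y} := d)))" by simp
      moreover have "subdivision_labelling G 4 c (f({v, y} := d))"
        using lab d by (intro subdivision_labelling_fun_upd) auto
      ultimately show thesis by (intro that[of "f({v, y} := d)"]) simp_all
    next
      case neq: False
      \<comment> \<open>Parity is changed by putting \<open>c x\<close> on the edge
        \<open>vy\<close>, which is admissible because both ends have other colours.\<close>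
      have "?cnt (f({v, y} := c x)) = Suc (?cnt f)"
        using neq W(4) fin by (intro card_fun_upd) auto
      with False have "odd (?cnt (f({v, y} := c x)))" by simp
      moreover have "subdivision_labelling G 4 c (f({v, y} := c x))"
        using lab cx4 cx W(5) by (intro subdivision_labelling_fun_upd) auto
      ultimately show thesis by (intro that[of "f({v, y} := c x)"]) simp_all
    qed
  qed
  obtain f2 where f2: "subdivision_labelling G 4 c f2" "\<forall>u \<in> W - {x}. odd_at (edges G) f2 u"
    "\<forall>e. \<not> e \<subseteq> W \<longrightarrow> f2 e = f1 e"
    using repair_all_but_root[OF G W(1) f1(1)] by blast
  obtain q where q: "q < 4" "q \<notin> c ` {v, x}" "odd_at (edges G) (f2({v, x} := q)) x"
    using repair_vertex[OF G f2(1) W(3), of x] by auto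
  let ?f = "f2({v, x} := q)"
  \<comment> \<open>The repairs inside \<open>W\<close> avoid \<open>v\<close>, and neither the old
    nor the new colour of \<open>vx\<close> is \<open>c x\<close>; so the count of
    \<open>c x\<close> at \<open>v\<close> stays odd.\<close>
  have "f2 {v, x} \<noteq> c x" using f2(1) W(3) by (auto simp: subdivision_labelling_def)
  moreover have "f2 e = f1 e" if "v \<in> e" for e using f2(3) W(2) that by blast
  moreover have "q \<noteq> c x" using q(2) by simp
  ultimately have
    "{e \<in> edges G. v \<in> e \<and> ?f e = c x} = {e \<in> edges G. v \<in> e \<and> f1 e = c x}"
    by (intro Collect_cong) (metis fun_upd_apply insertI1)
  with f1(2) have "odd_at (edges G) ?f v" by (intro odd_atI[of _ _ _ "c x"]) (simp only: not_False_eq_True)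
  moreover have "odd_at (edges G) ?f u" if "u \<in> W" for u
  proof (cases "u = x")
    case False
    have "odd_at (edges G) ?f u \<longleftrightarrow> odd_at (edges G) f2 u"
      using False that W(2) by (intro odd_at_cong) auto
    with f2(2) False that show ?thesis by auto
  qed (use q(3) in simp)
  moreover have "?f e = f e" if "e \<in> edges G" "e \<inter> insert v W = {}" for e
  proof -
    have "e \<noteq> {}" using G that(1) by (auto simp: fin_simple_graph_def)
    with that(2) have "\<not> e \<subseteq> W" "e \<noteq> {v, x}" "e \<noteq> {v, y}" by auto
    then show ?thesis using f2(3) f1(3) by simp
  qed
  moreover have "subdivision_labelling G 4 c ?f"
    using f2(1) q by (intro subdivision_labelling_fun_upd)
  ultimately show ?thesis by (intro exI[of _ ?f] conjI ballI impI) blast+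
qed

text \<open>Here \<open>v\<close> gets one of the two candidates for the colour of \<open>vx\<close>, and \<open>vx\<close> the other one,
  which then occurs exactly once around \<open>v\<close>.\<close>

lemma repair_leaf_one_color:
  assumes G: "fin_simple_graph G" and lab: "subdivision_labelling G 4 c f"
    and W: "grown (edges G) x W" "v \<notin> W" "{v, x} \<in> edges G"
    and mono: "\<And>y. {v, y} \<in> edges G \<Longrightarrow> c y = c x"
  shows "\<exists>c' f'. subdivision_labelling G 4 c' f' \<and> (\<forall>u \<in> insert v W. odd_at (edges G) f' u) \<and>
    (\<forall>e \<in> edges G. e \<inter> insert v W = {} \<longrightarrow> f' e = f e)"
proof -
  note fin = finite_edges[OF G]
  have vx: "v \<noteq> x" using grown_root[OF W(1)] W(2) by auto
  have at_v: "\<exists>y. e = {v, y} \<and> y \<noteq> v \<and> c y = c x" if "e \<in> edges G" "v \<in> e" for e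
    by (rule edge_doubleton[OF G that]) (use mono that(1) in auto)
  have "card ({..<4} - {c x}) = 3"
    using lab W(3) G by (subst card_Diff_singleton)
      (auto simp: subdivision_labelling_def fin_simple_graph_def)
  \<comment> \<open>All neighbours of \<open>v\<close> have colour \<open>c x\<close>, which leaves
    three colours: \<open>a\<close> goes on the edges at \<open>v\<close>, while \<open>p\<close>
    and \<open>q\<close> are shared out between \<open>v\<close> and \<open>vx\<close> at the
    end.\<close>
  then obtain a p q where "{..<4} - {c x} = {a, p, q}" and ne: "a \<noteq> p" "a \<noteq> q" "p \<noteq> q"
    by (auto simp: card_3_iff)
  then have apq: "a < 4" "p < 4" "q < 4" "a \<noteq> c x" "p \<noteq> c x" "q \<noteq> c x" by blast+
  define f1 where "f1 e = (if v \<in> e then a else f e)" for e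
  have lab': "subdivision_labelling G 4 (c(v := s)) g"
    if "s < 4" "s \<noteq> c x"
      "\<And>e. e \<in> edges G \<Longrightarrow> v \<notin> e \<Longrightarrow> g e < 4 \<and> g e \<notin> c ` e"
      "\<And>e. e \<in> edges G \<Longrightarrow> v \<in> e \<Longrightarrow> g e < 4 \<and> g e \<notin> {s, c x}" for s g
    unfolding subdivision_labelling_def
  proof (intro conjI ballI)
    fix u assume "u \<in> verts G"
    then show "(c(v := s)) u < 4" using lab that(1) by (auto simp: subdivision_labelling_def)
  next
    fix e assume e: "e \<in> edges G"
    show "g e < 4" using that(3,4)[OF e] by (cases "v \<in> e") auto
    show "inj_on (c(v := s)) e"
    proof (cases "v \<in> e")
      case True
      then show ?thesis using at_v[OF e] that(2) by auto
    next
      case False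
      moreover have "inj_on c e" using lab e by (auto simp: subdivision_labelling_def)
      ultimately show ?thesis by (auto simp: inj_on_def)
    qed
    show "g e \<notin> (c(v := s)) ` e"
    proof (cases "v \<in> e")
      case True
      with at_v[OF e] obtain y where "e = {v, y}" "y \<noteq> v" "c y = c x" by blast
      with that(4)[OF e True] show ?thesis by auto
    next
      case False
      with that(3)[OF e] show ?thesis by (auto simp: image_iff)
    qed
  qed
  \<comment> \<open>The colour \<open>p\<close> of \<open>v\<close> is provisional: the repairs
    inside \<open>W\<close> change only edges not containing \<open>v\<close>, so they remain
    admissible when \<open>v\<close> is recoloured.\<close>
  have "subdivision_labelling G 4 (c(v := p)) f1"
    using lab apq ne by (intro lab') (auto simp: f1_def subdivision_labelling_def)
  from repair_all_but_root[OF G W(1) this] obtain f2 where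
    f2: "subdivision_labelling G 4 (c(v := p)) f2" "\<forall>u \<in> W - {x}. odd_at (edges G) f2 u"
      "\<forall>e. \<not> e \<subseteq> W \<longrightarrow> f2 e = f1 e" by blast
  have f2_v: "f2 e = a" if "v \<in> e" for e
    using f2(3) that W(2) by (auto simp: f1_def)
  have f2_not_v: "f2 e < 4 \<and> f2 e \<notin> c ` e" if "e \<in> edges G" "v \<notin> e" for e
  proof -
    have "(c(v := p)) ` e = c ` e" using that(2) by (intro image_cong) auto
    with f2(1) that(1) show ?thesis by (metis subdivision_labelling_def)
  qed
  obtain s s' where s: "{s, s'} = {p, q}" "odd_at (edges G) (f2({v, x} := s)) x"
  proof (cases "odd_at (edges G) (f2({v, x} := p)) x")
    case True
    then show thesis by (intro that[of p q]) auto
  next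
    case False
    then have "odd_at (edges G) ((f2({v, x} := p))({v, x} := q)) x"
      using fin W(3) ne by (intro odd_at_fun_upd) auto
    then show thesis by (intro that[of q p]) auto
  qed
  then have s_ne: "s < 4" "s' < 4" "s \<noteq> s'" "s \<noteq> a" "s' \<noteq> a" "s \<noteq> c x" "s' \<noteq> c x"
    using apq ne by (auto simp: doubleton_eq_iff)
  let ?f = "f2({v, x} := s)"
  have "subdivision_labelling G 4 (c(v := s')) ?f"
    using s_ne apq f2_v f2_not_v by (intro lab') auto
  moreover have "odd_at (edges G) ?f u" if u: "u \<in> insert v W" for u
  proof -
    consider "u = v" | "u = x" | "u \<in> W - {x}" using u by blast
    then show ?thesis
    proof cases
      case 1
      have "{e \<in> edges G. v \<in> e \<and> ?f e = s} = {{v, x}}"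
        using f2_v W(3) s_ne by auto
      then have "odd (card {e \<in> edges G. v \<in> e \<and> ?f e = s})" by simp
      with 1 show ?thesis by (blast intro: odd_atI)
    next
      case 2
      with s(2) show ?thesis by simp
    next
      case 3
      then have "odd_at (edges G) ?f u \<longleftrightarrow> odd_at (edges G) f2 u"
        using W(2) by (intro odd_at_cong) auto
      with f2(2) 3 show ?thesis by auto
    qed
  qed
  moreover have "?f e = f e" if "e \<in> edges G" "e \<inter> insert v W = {}" for e
  proof -
    have "e \<noteq> {}" using G that(1) by (auto simp: fin_simple_graph_def)
    with that(2) have "\<not> e \<subseteq> W" "e \<noteq> {v, x}" by auto
    then show ?thesis using f2(3) that(2) by (simp add: f1_def)
  qed
  ultimately show ?thesis by blast
qed

text \<open>The last grown vertex \<open>v\<close> is a leaf. Rerooting the rest at its parent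
  \<open>x\<close> makes \<open>x\<close> the only vertex of the rest that the tree leaves open. If
  nothing was grown, closure under edges makes \<open>r\<close> isolated.\<close>

lemma repair_component:
  assumes G: "fin_simple_graph G" and lab: "subdivision_labelling G 4 c f"
    and W: "grown (edges G) r W" "\<And>e. e \<in> edges G \<Longrightarrow> e \<inter> W \<noteq> {} \<Longrightarrow> e \<subseteq> W"
  shows "\<exists>c' f'. subdivision_labelling G 4 c' f' \<and>
    (\<forall>u \<in> W. {e \<in> edges G. u \<in> e} \<noteq> {} \<longrightarrow> odd_at (edges G) f' u) \<and>
    (\<forall>e \<in> edges G. e \<inter> W = {} \<longrightarrow> f' e = f e)"
  using W(1)
proof cases
  case root
  have "{e \<in> edges G. r \<in> e} = {}"
  proof (rule ccontr)
    assume "{e \<in> edges G. r \<in> e} \<noteq> {}"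
    then obtain e where e: "e \<in> edges G" "r \<in> e" by blast
    obtain w where "e = {r, w}" "w \<noteq> r" using edge_doubleton[OF G e] by metis
    with W(2)[OF e(1)] root show False by auto
  qed
  with lab root show ?thesis by (intro exI[of _ c] exI[of _ f]) auto
next
  case (grow W' x v)
  then have x: "grown (edges G) x W'" "{v, x} \<in> edges G"
    using grown_reroot by (auto simp: insert_commute)
  have "\<exists>c' f'. subdivision_labelling G 4 c' f' \<and> (\<forall>u \<in> W. odd_at (edges G) f' u) \<and>
    (\<forall>e \<in> edges G. e \<inter> W = {} \<longrightarrow> f' e = f e)"
  proof (cases "\<exists>y. {v, y} \<in> edges G \<and> c y \<noteq> c x")
    case True
    then obtain y where "{v, y} \<in> edges G" "c y \<noteq> c x" by blast
    from repair_leaf_two_colors[OF G lab x(1) grow(4) x(2) this] grow(1) show ?thesis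
      by (intro exI[of _ c]) simp
  next
    case False
    then have "c y = c x" if "{v, y} \<in> edges G" for y using that by blast
    from repair_leaf_one_color[OF G lab x(1) grow(4) x(2) this] grow(1) show ?thesis by simp
  qed
  then show ?thesis by blast
qed

text \<open>Induction on vertex sets closed under edges, splitting off one component
  \<open>W\<close> at a time. Oddness depends on edge colours only, and repairing \<open>W\<close>
  keeps those of the edges disjoint from it.\<close>

lemma ex_odd_labelling:
  assumes G: "fin_simple_graph G" and c0: "proper_coloring G 4 c0"
  shows "\<exists>c f. subdivision_labelling G 4 c f \<and>
    (\<forall>v \<in> verts G. {e \<in> edges G. v \<in> e} \<noteq> {} \<longrightarrow> odd_at (edges G) f v)"
proof -
  have "\<exists>c f. subdivision_labelling G 4 c f \<and>
      (\<forall>v \<in> U. {e \<in> edges G. v \<in> e} \<noteq> {} \<longrightarrow> odd_at (edges G) f v)"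
    if "finite U" "U \<subseteq> verts G" "\<And>e. e \<in> edges G \<Longrightarrow> e \<inter> U \<noteq> {} \<Longrightarrow> e \<subseteq> U" for U
    using that
  proof (induction U rule: finite_psubset_induct)
    case (psubset U)
    show ?case
    proof (cases "U = {}")
      case True
      \<comment> \<open>The initial labelling: any colour admissible for \<open>c0\<close> on each
        edge.\<close>
      have "\<exists>k<4. k \<notin> c0 ` e" if "e \<in> edges G" for e
        using ex_less_notin_image_edge[OF G that] by simp
      then obtain f where f: "\<And>e. e \<in> edges G \<Longrightarrow> f e < 4 \<and> f e \<notin> c0 ` e" by metis
      have "inj_on c0 e" if "e \<in> edges G" for e
      proof (rule inj_onI, rule ccontr)
        fix u v assume uv: "u \<in> e" "v \<in> e" "c0 u = c0 v" "u \<noteq> v"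
        from edge_doubleton[OF G that uv(1)] uv have "e = {u, v}" "u \<in> verts G" "v \<in> verts G"
          by blast+
        with c0 that uv(3) show False by (auto simp: proper_coloring_def)
      qed
      with f c0 have "subdivision_labelling G 4 c0 f"
        by (auto simp: subdivision_labelling_def proper_coloring_def)
      with True show ?thesis by blast
    next
      case False
      then obtain r where r: "r \<in> U" by blast
      then obtain W where W: "grown (edges G) r W" "W \<subseteq> verts G"
        "\<And>e. e \<in> edges G \<Longrightarrow> e \<inter> W \<noteq> {} \<Longrightarrow> e \<subseteq> W"
        using ex_component[OF G] psubset.prems(1) by blast
      have "U - W \<subset> U" using grown_root[OF W(1)] r by blast
      moreover have "e \<subseteq> U - W" if "e \<in> edges G" "e \<inter> (U - W) \<noteq> {}" for e
        using psubset.prems(2)[of e] W(3)[of e] that by blast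
      ultimately obtain c f where cf: "subdivision_labelling G 4 c f"
        "\<forall>v \<in> U - W. {e \<in> edges G. v \<in> e} \<noteq> {} \<longrightarrow> odd_at (edges G) f v"
        using psubset.IH[of "U - W"] psubset.prems(1) by blast
      obtain c' f' where cf': "subdivision_labelling G 4 c' f'"
        "\<forall>v \<in> W. {e \<in> edges G. v \<in> e} \<noteq> {} \<longrightarrow> odd_at (edges G) f' v"
        "\<forall>e \<in> edges G. e \<inter> W = {} \<longrightarrow> f' e = f e"
        using repair_component[OF G cf(1) W(1,3)] by blast
      have "odd_at (edges G) f' v \<longleftrightarrow> odd_at (edges G) f v" if "v \<in> U - W" for v
        using cf'(3) W(3) that by (intro odd_at_cong) blast
      with cf(2) cf'(1,2) show ?thesis by blast
    qed
  qed
  from this[of "verts G"] G show ?thesis by (auto simp: fin_simple_graph_def)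
qed

section \<open>Chromatic numbers\<close>

lemma chromatic_number_le_imp_coloring:
  assumes "fin_simple_graph G" "chromatic_number G \<le> k"
  shows "\<exists>c. proper_coloring G k c"
proof -
  have "\<exists>k c. proper_coloring G k c" using ex_colorings[OF assms(1)] by blast
  then have "\<exists>c. proper_coloring G (chromatic_number G) c"
    unfolding chromatic_number_def by (rule LeastI_ex)
  moreover have "{..<chromatic_number G} \<subseteq> {..<k}" using assms(2) by auto
  ultimately show ?thesis unfolding proper_coloring_def by (meson subset_trans)
qed

lemma pcf_chromatic_number_full_subdivision_le:
  assumes G: "fin_simple_graph G" and "chromatic_number G \<le> 3"
  shows "pcf_chromatic_number (full_subdivision G) \<le> 4"
proof -
  obtain c0 where c0: "proper_coloring G 3 c0"
    using chromatic_number_le_imp_coloring[OF assms] by blast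
  obtain c f where cf: "subdivision_labelling G 4 c f"
    "\<And>v. v \<in> verts G \<Longrightarrow> {e \<in> edges G. v \<in> e} \<noteq> {} \<Longrightarrow>
      \<exists>i. card {e \<in> edges G. v \<in> e \<and> f e = i} = 1"
    using ex_cf_labelling[OF G c0] by blast
  have "proper_cf_coloring (full_subdivision G) 4 (case_sum c f)"
    unfolding proper_cf_coloring_def
    using proper_coloring_subdivision[OF cf(1)]
      subdivision_neighborhoods[OF G cf(1), where P = "\<lambda>n. n = 1", OF refl cf(2)] by blast
  then show ?thesis unfolding pcf_chromatic_number_def by (intro Least_le) blast
qed

lemma odd_chromatic_number_full_subdivision_le:
  assumes G: "fin_simple_graph G" and "chromatic_number G \<le> 4"
  shows "odd_chromatic_number (full_subdivision G) \<le> 4"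
proof -
  obtain c0 where c0: "proper_coloring G 4 c0"
    using chromatic_number_le_imp_coloring[OF assms] by blast
  obtain c f where cf: "subdivision_labelling G 4 c f"
    "\<And>v. v \<in> verts G \<Longrightarrow> {e \<in> edges G. v \<in> e} \<noteq> {} \<Longrightarrow>
      \<exists>i. odd (card {e \<in> edges G. v \<in> e \<and> f e = i})"
    using ex_odd_labelling[OF G c0] unfolding odd_at_def by blast
  have "proper_odd_coloring (full_subdivision G) 4 (case_sum c f)"
    unfolding proper_odd_coloring_def
    using proper_coloring_subdivision[OF cf(1)]
      subdivision_neighborhoods[OF G cf(1), where P = odd, OF odd_one cf(2)] by blast
  then show ?thesis unfolding odd_chromatic_number_def by (intro Least_le) blast
qed

section \<open>The lower bound for the subdivided 4-cycle\<close>

lemma odd_coloring_two_neighbors: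
  assumes "proper_odd_coloring G k c" "v \<in> verts G" "neighborhood G v = {a, b}" "a \<noteq> b"
  shows "c a \<noteq> c b"
proof
  assume eq: "c a = c b"
  obtain i where "odd (card {u \<in> {a, b}. c u = i})"
    using assms(1-3) by (auto simp: proper_odd_coloring_def)
  moreover have "{u \<in> {a, b}. c u = i} = (if c a = i then {a, b} else {})" using eq by auto
  ultimately show False using assms(4) by (auto split: if_splits)
qed

definition cycle4 :: "nat graph" where
  "cycle4 = Graph {0, 1, 2, 3} {{0, 1}, {1, 2}, {2, 3}, {3, 0}}"

lemma fin_simple_graph_cycle4: "fin_simple_graph cycle4"
  by (auto simp: fin_simple_graph_def cycle4_def)

lemma bipartite_cycle4: "bipartite cycle4"
  unfolding bipartite_def
  by (rule exI[of _ "{0, 2}"], rule exI[of _ "{1, 3}"]) (auto simp: cycle4_def)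

lemma chromatic_number_cycle4_le: "chromatic_number cycle4 \<le> 2"
proof -
  have "proper_coloring cycle4 2 (\<lambda>v. v mod 2)"
    by (auto simp: proper_coloring_def cycle4_def doubleton_eq_iff)
  then show ?thesis unfolding chromatic_number_def by (intro Least_le) blast
qed

text \<open>All degrees in the subdivision are two, so the two neighbours of every vertex differ in
  colour: at new vertices this separates adjacent vertices of the cycle, at old ones consecutive
  edges.\<close>

lemma not_odd_coloring_subdivided_cycle4:
  assumes "k \<le> 3"
  shows "\<not> proper_odd_coloring (full_subdivision cycle4) k c"
proof
  assume c: "proper_odd_coloring (full_subdivision cycle4) k c"
  note G = fin_simple_graph_cycle4
  let ?v = "\<lambda>v. c (Inl v)" and ?e = "\<lambda>u v. c (Inr {u, v})"
  have proper: "proper_coloring (full_subdivision cycle4) k c"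
    using c by (simp add: proper_odd_coloring_def)
  have less: "c x < 3" if "x \<in> verts (full_subdivision cycle4)" for x
    using proper that assms by (fastforce simp: proper_coloring_def)
  have edge: "?v u \<noteq> ?v v \<and> ?e u v \<noteq> ?v u \<and> ?e u v \<noteq> ?v v \<and> ?v u < 3 \<and> ?v v < 3 \<and> ?e u v < 3"
    if uv: "{u, v} \<in> edges cycle4" for u v
  proof -
    have vs: "u \<in> verts cycle4" "v \<in> verts cycle4" "u \<noteq> v"
      using G uv by (auto simp: fin_simple_graph_def)
    have mem: "Inl u \<in> verts (full_subdivision cycle4)" "Inl v \<in> verts (full_subdivision cycle4)"
      "Inr {u, v} \<in> verts (full_subdivision cycle4)"
      using vs uv by simp_all
    moreover have "{Inl w, Inr {u, v}} \<in> edges (full_subdivision cycle4)"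
      if "w \<in> {u, v}" for w
      using that uv by simp
    ultimately have "?v u \<noteq> ?e u v" "?v v \<noteq> ?e u v"
      using proper unfolding proper_coloring_def by blast+
    moreover have "?v u \<noteq> ?v v"
      using odd_coloring_two_neighbors[OF c mem(3)] neighborhood_subdivision_Inr[OF G uv] vs(3)
      by auto
    ultimately show ?thesis using less mem by auto
  qed
  have vertex: "?e u v \<noteq> ?e v w"
    if "v \<in> verts cycle4" "{e \<in> edges cycle4. v \<in> e} = {{u, v}, {v, w}}" "u \<noteq> w" for u v w
  proof (rule odd_coloring_two_neighbors[OF c])
    show "Inl v \<in> verts (full_subdivision cycle4)"
      using that(1) by simp
    show "neighborhood (full_subdivision cycle4) (Inl v) = {Inr {u, v}, Inr {v, w}}"
      using that(2) neighborhood_subdivision_Inl[of cycle4 v] by simp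
    show "Inr {u, v} \<noteq> Inr {v, w}" using that(3) by (auto simp: doubleton_eq_iff)
  qed
  have edges: "edges cycle4 = {{0, 1}, {1, 2}, {2, 3}, {3, 0}}" by (simp add: cycle4_def)
  have consecutive: "?e 0 1 \<noteq> ?e 1 2" "?e 1 2 \<noteq> ?e 2 3"
    by (rule vertex; auto simp: cycle4_def)+
  \<comment> \<open>Among three colours, two different ones leave a single third.\<close>
  have third: "x = y"
    if "a \<noteq> b" "x \<notin> {a, b}" "y \<notin> {a, b}" "a < 3" "b < 3" "x < 3" "y < 3"
    for a b x y :: nat
    using that by auto
  note edge01 = edge[of 0 1, unfolded edges, simplified]
    and edge12 = edge[of 1 2, unfolded edges, simplified]
    and edge23 = edge[of 2 3, unfolded edges, simplified]
    and edge30 = edge[of 3 0, unfolded edges, simplified]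
  show False
  proof (cases "?v 0 = ?v 2")
    case True
    have "?e 0 1 = ?e 1 2"
      by (rule third[of "?v 0" "?v 1"]) (use True edge01 edge12 in simp_all)
    with consecutive show False by blast
  next
    case False
    \<comment> \<open>Both vertices avoid the two different colours of 0 and 2.\<close>
    then have "?v 1 = ?v 3"
      by (rule third) (use edge01 edge12 edge23 edge30 in auto)
    then have "?e 1 2 = ?e 2 3"
      using edge12 edge23 by (intro third[of "?v 1" "?v 2"]) simp_all
    with consecutive show False by blast
  qed
qed

theorem proposition1p8:
  "(\<forall>G :: 'a graph. fin_simple_graph G \<longrightarrow>
      (chromatic_number G \<le> 3 \<longrightarrow> pcf_chromatic_number (full_subdivision G) \<le> 4) \<and>
      (chromatic_number G \<le> 4 \<longrightarrow> odd_chromatic_number (full_subdivision G) \<le> 4)) \<and>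
   (\<exists>H :: nat graph. fin_simple_graph H \<and> bipartite H \<and>
      odd_chromatic_number (full_subdivision H) = 4)"
proof -
  have le: "odd_chromatic_number (full_subdivision cycle4) \<le> 4"
    using odd_chromatic_number_full_subdivision_le[OF fin_simple_graph_cycle4]
      chromatic_number_cycle4_le by simp
  \<comment> \<open>The minimum is attained, so a value of at most 3 would yield an excluded
    colouring.\<close>
  have "\<exists>k c. proper_odd_coloring (full_subdivision cycle4) k c"
    using ex_colorings[OF fin_simple_graph_full_subdivision[OF fin_simple_graph_cycle4]] by blast
  then have "\<exists>c. proper_odd_coloring (full_subdivision cycle4)
      (odd_chromatic_number (full_subdivision cycle4)) c"
    unfolding odd_chromatic_number_def by (rule LeastI_ex)
  with not_odd_coloring_subdivided_cycle4 have
    "\<not> odd_chromatic_number (full_subdivision cycle4) \<le> 3" by blast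
  with le have "odd_chromatic_number (full_subdivision cycle4) = 4" by simp
  with pcf_chromatic_number_full_subdivision_le odd_chromatic_number_full_subdivision_le
    fin_simple_graph_cycle4 bipartite_cycle4 show ?thesis by blast
qed

end
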